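(* Let $\Gamma\subseteq\mathrm{Sym}(N)$ be a permutation group and let $v\in\mathcal{S}_d(\Gamma)$ be irreducible with arrangement space $U\subseteq\mathbb{R}^n$ and representation $T$. The following are equivalent: (i) The arrangement $v$ is flexible. (ii) There exists an arrangement $\bar v\in\mathcal{S}_d(\Gamma)$, not equivalent to $v$, with a representation isomorphic to $T$. (iii) There exists a $\Gamma$-invariant subspace $\bar U\subseteq\mathbb{R}^n$ different from $U$ that is non-orthogonal to $U$ (i.e. $\bar U\not\perp U$).
   Context: Let $n,d\ge 1$ and $N=\{1,\dots,n\}$. A $d$-dimensional arrangement is a family of points $v_i\in\mathbb{R}^d$, $i\in N$; its matrix $M\in\mathbb{R}^{n\times d}$ has $i$-th row $v_i^\top$ and its arrangement space is the column span $U=\mathrm{span}\,M\subseteq\mathbb{R}^n$. Two arrangements are equivalent if they have the same arrangement space. An arrangement is normalized if $M^\top M=\mathrm{Id}$. For a permutation group $\Gamma\subseteq\mathrm{Sym}(N)$, $v$ is a $\Gamma$-arrangement if there is a group homomorphism $T\colon\Gamma\to\mathrm{O}(\mathbb{R}^d)$ with $T_\phi v_i=v_{\phi(i)}$ for all $i\in N$, $\phi\in\Gamma$; $T$ is called the representation of $v$ (it is unique if the $v_i$ span $\mathbb{R}^d$, in particular if $v$ is normalized). $v$ is irreducible if its representation is irreducible over $\mathbb{R}$. Two representations $T,\bar T$ are isomorphic if there is an invertible linear map $R$ with $RT_\phi=\bar T_\phi R$ for all $\phi\in\Gamma$. $\Gamma$ acts on $\mathbb{R}^n$ by permutation matrices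 $P_\phi$ with $P_\phi e_i=e_{\phi(i)}$ for the standard basis vectors $e_i$; a subspace of $\mathbb{R}^n$ is $\Gamma$-invariant if it is mapped to itself by all $P_\phi$, $\phi\in\Gamma$. $\mathcal{S}_d(\Gamma)$ is the set of $d$-dimensional normalized $\Gamma$-arrangements on $N$, with the subspace topology from $(\mathbb{R}^d)^n$. An arrangement $v\in\mathcal{S}_d(\Gamma)$ can be deformed into $\bar v\in\mathcal{S}_d(\Gamma)$ if there is a continuous map $v(\cdot)\colon[0,1]\to\mathcal{S}_d(\Gamma)$ with $v(0)=v$ and $v(1)=\bar v$. An arrangement $v\in\mathcal{S}_d(\Gamma)$ is rigid if it cannot be deformed into any non-equivalent arrangement of $\mathcal{S}_d(\Gamma)$; otherwise it is flexible.
   Formalization: In (iii) the invariant subspace Ū is required to be irreducible; for arbitrary invariant subspaces the claim fails (n=2, Γ=Sym(2), d=1, v_1=v_2=1/√2 is rigid, yet Ū=ℝ² is invariant, different from U and non-orthogonal to U). *)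

theory Defs
  imports "HOL-Analysis.Analysis" "HOL-Algebra.Bij"
begin

text \<open>
  An arrangement is identified with its matrix \<open>v :: real^'d^'n\<close>, whose row \<open>v $ i\<close> is the
  point \<open>v\<^sub>i\<close>. The index type \<open>'n\<close> plays the role of \<open>N\<close>, and \<open>n = CARD('n)\<close>, \<open>d = CARD('d)\<close>.
\<close>

definition arrangement_space :: "real^'d^'n \<Rightarrow> (real^'n) set" where
  "arrangement_space v = span (columns v)"

definition equivalent_arr :: "real^'d^'n \<Rightarrow> real^'d^'n \<Rightarrow> bool" where
  "equivalent_arr v w \<longleftrightarrow> arrangement_space v = arrangement_space w"

definition normalized_arr :: "real^'d^'n \<Rightarrow> bool" where
  "normalized_arr v \<longleftrightarrow> transpose v ** v = mat 1"

definition permutation_group :: "('n \<Rightarrow> 'n) set \<Rightarrow> bool" where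
  "permutation_group \<Gamma> \<longleftrightarrow> subgroup \<Gamma> (BijGroup UNIV)"

definition orthogonal_group :: "(real^'d^'d) monoid" where
  "orthogonal_group = \<lparr>carrier = {A. orthogonal_matrix A}, mult = (**), one = mat 1\<rparr>"

definition is_representation ::
    "('n \<Rightarrow> 'n) set \<Rightarrow> real^'d^'n \<Rightarrow> (('n \<Rightarrow> 'n) \<Rightarrow> real^'d^'d) \<Rightarrow> bool" where
  "is_representation \<Gamma> v T \<longleftrightarrow>
     T \<in> hom ((BijGroup UNIV)\<lparr>carrier := \<Gamma>\<rparr>) orthogonal_group \<and>
     (\<forall>\<phi>\<in>\<Gamma>. \<forall>i. T \<phi> *v (v $ i) = v $ (\<phi> i))"

definition sym_arr :: "('n \<Rightarrow> 'n) set \<Rightarrow> real^'d^'n \<Rightarrow> bool" where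
  "sym_arr \<Gamma> v \<longleftrightarrow> (\<exists>T. is_representation \<Gamma> v T)"

definition arrangements :: "('n \<Rightarrow> 'n) set \<Rightarrow> (real^'d^'n) set" where
  "arrangements \<Gamma> = {v. normalized_arr v \<and> sym_arr \<Gamma> v}"

definition perm_matrix :: "('n \<Rightarrow> 'n) \<Rightarrow> real^'n^'n" where
  "perm_matrix \<phi> = (\<chi> i j. if i = \<phi> j then 1 else 0)"

lemma perm_matrix_axis: "perm_matrix \<phi> *v axis j 1 = axis (\<phi> j) 1"
  by (simp add: perm_matrix_def vec_eq_iff matrix_vector_mul_component inner_axis) (simp add: axis_def)

text \<open>
  In the next two definitions \<open>R\<close> is a family of matrices indexed by \<open>\<Gamma>\<close>; they are used both for
  \<open>R = T\<close> acting on \<open>real^'d\<close> and for \<open>R = perm_matrix\<close> acting on \<open>real^'n\<close>.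

  The theorem compares the arrangement space \<open>U\<close> with \<^emph>\<open>irreducible\<close> invariant subspaces only.
  If arbitrary invariant subspaces were admitted, \<open>UNIV\<close> would be one that is non-orthogonal to
  and different from every \<open>U\<close> other than \<open>{0}\<close> and \<open>UNIV\<close>; but for \<open>\<Gamma> = Sym({1,2})\<close>,
  \<open>d = 1\<close> and \<open>v\<^sub>1 = v\<^sub>2 = 1 / sqrt 2\<close> the arrangement is rigid.
\<close>

definition invariant_subspace ::
    "'g set \<Rightarrow> ('g \<Rightarrow> real^'m^'m) \<Rightarrow> (real^'m) set \<Rightarrow> bool" where
  "invariant_subspace \<Gamma> R W \<longleftrightarrow> subspace W \<and> (\<forall>\<phi>\<in>\<Gamma>. (\<lambda>x. R \<phi> *v x) ` W \<subseteq> W)"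

definition irreducible_subspace ::
    "'g set \<Rightarrow> ('g \<Rightarrow> real^'m^'m) \<Rightarrow> (real^'m) set \<Rightarrow> bool" where
  "irreducible_subspace \<Gamma> R W \<longleftrightarrow>
     invariant_subspace \<Gamma> R W \<and> W \<noteq> {0} \<and>
     (\<forall>W'. invariant_subspace \<Gamma> R W' \<and> W' \<subseteq> W \<longrightarrow> W' = {0} \<or> W' = W)"

definition irreducible_rep :: "'g set \<Rightarrow> ('g \<Rightarrow> real^'d^'d) \<Rightarrow> bool" where
  "irreducible_rep \<Gamma> T \<longleftrightarrow> irreducible_subspace \<Gamma> T UNIV"

definition isomorphic_rep ::
    "'g set \<Rightarrow> ('g \<Rightarrow> real^'d^'d) \<Rightarrow> ('g \<Rightarrow> real^'d^'d) \<Rightarrow> bool" where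
  "isomorphic_rep \<Gamma> T T' \<longleftrightarrow> (\<exists>R. invertible R \<and> (\<forall>\<phi>\<in>\<Gamma>. R ** T \<phi> = T' \<phi> ** R))"

definition deformable :: "('n \<Rightarrow> 'n) set \<Rightarrow> real^'d^'n \<Rightarrow> real^'d^'n \<Rightarrow> bool" where
  "deformable \<Gamma> v w \<longleftrightarrow> path_component (arrangements \<Gamma>) v w"

definition rigid :: "('n \<Rightarrow> 'n) set \<Rightarrow> real^'d^'n \<Rightarrow> bool" where
  "rigid \<Gamma> v \<longleftrightarrow> \<not> (\<exists>w\<in>arrangements \<Gamma>. deformable \<Gamma> v w \<and> \<not> equivalent_arr v w)"

abbreviation flexible :: "('n \<Rightarrow> 'n) set \<Rightarrow> real^'d^'n \<Rightarrow> bool" where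
  "flexible \<Gamma> v \<equiv> \<not> rigid \<Gamma> v"

end

theory Submission
  imports Defs
begin

text \<open>
  An arrangement matrix \<open>v\<close> with representation \<open>T\<close> is the same thing as a matrix that intertwines
  \<open>T\<close> with the permutation matrices (\<open>intertwiner_perm_matrix_iff\<close>), and its arrangement space is
  the range of \<open>v\<close>. The theorem is thus about equivariant linear maps from an irreducible
  orthogonal representation into \<open>\<real>\<^sup>n\<close>. Write (i), (ii), (iii) for flexibility, for the existence
  of a non-equivalent arrangement with an isomorphic representation, and for the existence of an
  irreducible invariant subspace that differs from \<open>U\<close> and is not orthogonal to it.

  (i) implies (ii): the representation of a normalized arrangement \<open>v\<close> can be read off as
  \<open>v\<^sup>T P\<^sub>\<phi> v\<close>. For two arrangements \<open>v\<close> and \<open>w\<close> the overlap \<open>w\<^sup>T v\<close> intertwines their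
  representations, and for \<open>w\<close> close to \<open>v\<close> it is close to the identity, hence invertible. So the
  isomorphism type of the representation is locally constant, and it cannot change along a path
  (\<open>deformable_imp_isomorphic_gram_rep\<close>).

  (ii) implies (iii): after composition with the isomorphism, \<open>w\<close> becomes an intertwiner \<open>B\<close> for
  \<open>T\<close>. Its range is irreducible and differs from \<open>U\<close>. If it is orthogonal to \<open>U\<close>, then the
  range of \<open>v + B\<close>, a diagonal in the sum of the two spaces, is as required
  (\<open>irreducible_subspace_of_isomorphic_arrangement\<close>).

  (iii) implies (i): \<open>v\<^sup>T\<close> restricts to a nonzero equivariant map from \<open>U'\<close> to \<open>\<real>\<^sup>d\<close>, which is
  bijective because both sides are irreducible. By Schur's lemma (\<open>Schur_gram_matrix\<close>) its inverse
  is a similarity, so rescaling it gives a normalized arrangement \<open>w\<close> with the same representation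
  \<open>T\<close>, with arrangement space \<open>U'\<close>, and with \<open>v\<^sup>T w\<close> a positive multiple of the identity
  (\<open>arrangement_of_irreducible_subspace\<close>). The last property makes every convex combination of
  \<open>v\<close> and \<open>w\<close> a positive multiple of a normalized arrangement, and dividing by the factor gives the
  deformation (\<open>deformable_of_positive_overlap\<close>).
\<close>

(* Keeps matrices on the left of vectors, so that facts about *v apply to transposes as well. *)
declare transpose_matrix_vector [simp del]

section \<open>Intertwining matrices\<close>

definition intertwiner ::
    "'g set \<Rightarrow> ('g \<Rightarrow> real^'a^'a) \<Rightarrow> ('g \<Rightarrow> real^'b^'b) \<Rightarrow> real^'a^'b \<Rightarrow> bool" where
  "intertwiner \<Gamma> T S A \<longleftrightarrow> (\<forall>\<phi>\<in>\<Gamma>. A ** T \<phi> = S \<phi> ** A)"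

lemma matrix_add_mult_distrib: "(A + B) ** C = A ** C + B ** C"
  for A B :: "real^'a^'b" and C :: "real^'c^'a"
  by (simp add: matrix_eq matrix_vector_mult_add_rdistrib flip: matrix_vector_mul_assoc)

lemma orthogonal_matrix_iff_norm:
  "orthogonal_matrix Q \<longleftrightarrow> (\<forall>x. norm (Q *v x) = norm x)" for Q :: "real^'a^'a"
  using orthogonal_transformation_matrix[of "(*v) Q"] by (simp add: orthogonal_transformation)

lemma intertwiner_apply:
  assumes "intertwiner \<Gamma> T S A" "\<phi> \<in> \<Gamma>"
  shows "A *v (T \<phi> *v x) = S \<phi> *v (A *v x)"
  using assms by (simp add: intertwiner_def matrix_vector_mul_assoc)

lemma intertwiner_scaleR:
  "intertwiner \<Gamma> T S A \<Longrightarrow> intertwiner \<Gamma> T S (c *\<^sub>R A)"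
  by (simp add: intertwiner_def matrix_scalar_ac flip: scalar_matrix_assoc)

lemma intertwiner_add:
  "intertwiner \<Gamma> T S A \<Longrightarrow> intertwiner \<Gamma> T S B \<Longrightarrow> intertwiner \<Gamma> T S (A + B)"
  by (simp add: intertwiner_def matrix_add_ldistrib matrix_add_mult_distrib)

lemma intertwiner_compose:
  assumes "intertwiner \<Gamma> S R B" "intertwiner \<Gamma> T S A"
  shows "intertwiner \<Gamma> T R (B ** A)"
  using assms unfolding intertwiner_def by (metis matrix_mul_assoc)

text \<open>
  For orthogonal representations, transposition amounts to replacing every group element by its
  inverse on both sides of the intertwining identity.
\<close>

lemma intertwiner_transpose:
  assumes A: "intertwiner \<Gamma> T S A"
    and T: "\<And>\<phi>. \<phi> \<in> \<Gamma> \<Longrightarrow> orthogonal_matrix (T \<phi>)"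
    and S: "\<And>\<phi>. \<phi> \<in> \<Gamma> \<Longrightarrow> orthogonal_matrix (S \<phi>)"
  shows "intertwiner \<Gamma> S T (transpose A)"
  unfolding intertwiner_def
proof
  fix \<phi> assume \<phi>: "\<phi> \<in> \<Gamma>"
  have "transpose (A ** T \<phi>) = transpose (S \<phi> ** A)"
    using A \<phi> by (simp add: intertwiner_def)
  then have eq: "transpose (T \<phi>) ** transpose A = transpose A ** transpose (S \<phi>)"
    by (simp add: matrix_transpose_mul)
  have TT: "T \<phi> ** transpose (T \<phi>) = mat 1" and SS: "transpose (S \<phi>) ** S \<phi> = mat 1"
    using T S \<phi> by (auto simp: orthogonal_matrix_def)
  have "transpose A ** S \<phi> = T \<phi> ** (transpose (T \<phi>) ** transpose A) ** S \<phi>"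
    by (metis TT matrix_mul_assoc matrix_mul_lid)
  also have "\<dots> = T \<phi> ** transpose A"
    unfolding eq by (metis SS matrix_mul_assoc matrix_mul_rid)
  finally show "transpose A ** S \<phi> = T \<phi> ** transpose A" .
qed

lemma invariant_subspace_preimage:
  assumes A: "intertwiner \<Gamma> T S A" and W: "invariant_subspace \<Gamma> S W"
  shows "invariant_subspace \<Gamma> T {x. A *v x \<in> W}"
proof -
  have "subspace W" and Winv: "\<And>\<phi> y. \<phi> \<in> \<Gamma> \<Longrightarrow> y \<in> W \<Longrightarrow> S \<phi> *v y \<in> W"
    using W by (auto simp: invariant_subspace_def)
  then show ?thesis
    unfolding invariant_subspace_def subspace_def
    by (auto simp: algebra_simps intertwiner_apply[OF A])
qed

lemma invariant_subspace_image:
  assumes A: "intertwiner \<Gamma> T S A" and W: "invariant_subspace \<Gamma> T W"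
  shows "invariant_subspace \<Gamma> S ((*v) A ` W)"
proof -
  have "subspace W" and Winv: "\<And>\<phi> y. \<phi> \<in> \<Gamma> \<Longrightarrow> y \<in> W \<Longrightarrow> T \<phi> *v y \<in> W"
    using W by (auto simp: invariant_subspace_def)
  then show ?thesis
    unfolding invariant_subspace_def
    by (auto simp: linear_subspace_image simp flip: intertwiner_apply[OF A])
qed

lemma invariant_subspace_Int:
  assumes "invariant_subspace \<Gamma> T V" "invariant_subspace \<Gamma> T W"
  shows "invariant_subspace \<Gamma> T (V \<inter> W)"
  using assms by (fastforce simp: invariant_subspace_def subspace_inter)

lemma invariant_subspace_zero: "invariant_subspace \<Gamma> T {0}"
  by (auto simp: invariant_subspace_def)

lemma invariant_subspace_UNIV: "invariant_subspace \<Gamma> T UNIV"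
  by (auto simp: invariant_subspace_def)

lemma irreducible_repD:
  "irreducible_rep \<Gamma> T \<Longrightarrow> invariant_subspace \<Gamma> T W \<Longrightarrow> W \<noteq> {0} \<Longrightarrow> W = UNIV"
  by (auto simp: irreducible_rep_def irreducible_subspace_def)

text \<open>
  Invariant subspaces of the range pull back to invariant subspaces of the irreducible source, so
  there is no room for a proper one.
\<close>

lemma irreducible_range:
  assumes T: "irreducible_rep \<Gamma> T" and A: "intertwiner \<Gamma> T S A" and "A \<noteq> 0"
  shows "irreducible_subspace \<Gamma> S (range ((*v) A))"
  unfolding irreducible_subspace_def
proof (intro conjI allI impI)
  show "invariant_subspace \<Gamma> S (range ((*v) A))"
    by (rule invariant_subspace_image[OF A invariant_subspace_UNIV])
  show "range ((*v) A) \<noteq> {0}"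
    using \<open>A \<noteq> 0\<close> by (auto simp: matrix_eq)
  fix W assume W: "invariant_subspace \<Gamma> S W \<and> W \<subseteq> range ((*v) A)"
  then have "invariant_subspace \<Gamma> T {x. A *v x \<in> W}"
    using A invariant_subspace_preimage by blast
  then have "{x. A *v x \<in> W} = {0} \<or> {x. A *v x \<in> W} = UNIV"
    using irreducible_repD[OF T] by blast
  then show "W = {0} \<or> W = range ((*v) A)"
  proof
    assume *: "{x. A *v x \<in> W} = {0}"
    then have "A *v 0 \<in> W" by blast
    then have "0 \<in> W" by simp
    moreover have "y = 0" if y: "y \<in> W" for y
    proof -
      obtain x where "y = A *v x"
        using W y by blast
      with y have "x \<in> {x. A *v x \<in> W}" by simp
      then have "x = 0" unfolding * by simp
      with \<open>y = A *v x\<close> show ?thesis by simp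
    qed
    ultimately have "W = {0}" by blast
    then show ?thesis ..
  next
    assume "{x. A *v x \<in> W} = UNIV"
    with W show ?thesis by auto
  qed
qed

section \<open>A real form of Schur's lemma\<close>

text \<open>By polarization, the norms alone determine the inner products.\<close>

lemma gram_matrix_of_similarity:
  fixes A :: "real^'a^'b"
  assumes K: "\<And>x. norm (A *v x) = K * norm x"
  shows "transpose A ** A = K\<^sup>2 *\<^sub>R mat 1"
proof -
  have "inner (A *v x) (A *v y) = K\<^sup>2 * inner x y" for x y
  proof -
    have "norm (A *v x + A *v y) = K * norm (x + y)"
      using K[of "x + y"] by (simp add: matrix_vector_right_distrib)
    then show ?thesis
      by (simp add: dot_norm K power_mult_distrib algebra_simps)
  qed
  moreover have "inner x ((transpose A ** A) *v y) = inner (A *v x) (A *v y)" for x y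
    by (simp add: vector_transpose_matrix flip: matrix_vector_mul_assoc dot_lmul_matrix)
  ultimately have "inner x ((transpose A ** A) *v y) = inner x ((K\<^sup>2 *\<^sub>R mat 1) *v y)" for x y
    by (simp flip: scaleR_matrix_vector_assoc)
  then have "(transpose A ** A) *v y = (K\<^sup>2 *\<^sub>R mat 1) *v y" for y
    by (metis vector_eq_ldot)
  then show ?thesis
    by (simp add: matrix_eq)
qed

text \<open>
  If \<open>x\<close> and \<open>y\<close> are stretched by exactly \<open>K\<close>, then by the parallelogram law the bounds for
  \<open>x + y\<close> and \<open>x - y\<close> add up to an equality, so that both are attained. If \<open>K\<close> is the operator
  norm, this subspace is the eigenspace of \<open>A\<^sup>T A\<close> for its largest eigenvalue, obtained here without
  spectral theory.
\<close>

lemma subspace_of_maximal_stretch: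
  fixes A :: "real^'a^'b"
  assumes le: "\<And>x. norm (A *v x) \<le> K * norm x"
  shows "subspace {x. norm (A *v x) = K * norm x}"
  unfolding subspace_def
proof (intro conjI ballI allI)
  fix x y assume "x \<in> {x. norm (A *v x) = K * norm x}" "y \<in> {x. norm (A *v x) = K * norm x}"
  then have x: "norm (A *v x) = K * norm x" and y: "norm (A *v y) = K * norm y"
    by auto
  have parallelogram: "(norm (a + b))\<^sup>2 + (norm (a - b))\<^sup>2 = 2 * (norm a)\<^sup>2 + 2 * (norm b)\<^sup>2"
    for a b :: "real^'c"
    by (simp add: power2_norm_eq_inner inner_add inner_diff inner_commute)
  have "(norm (A *v (x + y)))\<^sup>2 + (norm (A *v (x - y)))\<^sup>2
      = K\<^sup>2 * ((norm (x + y))\<^sup>2 + (norm (x - y))\<^sup>2)"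
    unfolding parallelogram matrix_vector_right_distrib matrix_vector_mult_diff_distrib x y
    by (simp add: power_mult_distrib algebra_simps)
  then have sum_eq: "(norm (A *v (x + y)))\<^sup>2 + (norm (A *v (x - y)))\<^sup>2
      = (K * norm (x + y))\<^sup>2 + (K * norm (x - y))\<^sup>2"
    by (simp add: power_mult_distrib algebra_simps)
  have "(norm (A *v (x - y)))\<^sup>2 \<le> (K * norm (x - y))\<^sup>2"
    using le by (intro power_mono) auto
  with sum_eq have "(K * norm (x + y))\<^sup>2 \<le> (norm (A *v (x + y)))\<^sup>2"
    by linarith
  then have "K * norm (x + y) \<le> norm (A *v (x + y))"
    by (rule power2_le_imp_le) auto
  with le[of "x + y"] show "x + y \<in> {x. norm (A *v x) = K * norm x}"
    by auto
qed (auto simp: matrix_vector_mult_scaleR)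

text \<open>
  The vectors that \<open>A\<close> stretches the most form a subspace. It is nonzero by compactness of the
  sphere, and it is invariant because the two representations preserve norms. By irreducibility it
  is everything, so \<open>A\<close> is a similarity. The endomorphisms of a real irreducible representation
  need not be scalar, but the self-adjoint one \<open>A\<^sup>T A\<close> is.
\<close>

lemma Schur_gram_matrix:
  fixes T :: "'g \<Rightarrow> real^'a^'a" and S :: "'g \<Rightarrow> real^'b^'b"
  assumes T: "irreducible_rep \<Gamma> T" and A: "intertwiner \<Gamma> T S A" and "A \<noteq> 0"
    and oT: "\<And>\<phi>. \<phi> \<in> \<Gamma> \<Longrightarrow> orthogonal_matrix (T \<phi>)"
    and oS: "\<And>\<phi>. \<phi> \<in> \<Gamma> \<Longrightarrow> orthogonal_matrix (S \<phi>)"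
  obtains c where "c > 0" "transpose A ** A = c\<^sup>2 *\<^sub>R mat 1"
proof -
  have nT: "norm (T \<phi> *v x) = norm x" and nS: "norm (S \<phi> *v y) = norm y"
    if "\<phi> \<in> \<Gamma>" for \<phi> x y
    using oT[OF that] oS[OF that]
    by (auto simp: orthogonal_matrix_iff_norm)
  obtain x\<^sub>0 :: "real^'a" where x0: "norm x\<^sub>0 = 1"
    and max: "\<And>x. norm x = 1 \<Longrightarrow> norm (A *v x) \<le> norm (A *v x\<^sub>0)"
  proof -
    have "continuous_on (sphere 0 1) (\<lambda>x. norm (A *v x))"
      by (intro continuous_on_norm linear_continuous_on matrix_vector_mul_bounded_linear)
    moreover have "sphere 0 1 \<noteq> ({} :: (real^'a) set)"
      by simp
    ultimately obtain x\<^sub>0 where "x\<^sub>0 \<in> sphere 0 1"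
        "\<forall>x\<in>sphere 0 1. norm (A *v x) \<le> norm (A *v x\<^sub>0)"
      using continuous_attains_sup[OF compact_sphere] by blast
    then show ?thesis
      by (intro that[of x\<^sub>0]) auto
  qed
  define K where "K = norm (A *v x\<^sub>0)"
  have le: "norm (A *v x) \<le> K * norm x" for x
  proof (cases "x = 0")
    case False
    have "norm (A *v ((1 / norm x) *\<^sub>R x)) \<le> K"
      unfolding K_def using False by (intro max) simp
    then show ?thesis
      using False by (simp add: matrix_vector_mult_scaleR field_simps)
  qed simp
  let ?W = "{x. norm (A *v x) = K * norm x}"
  have "invariant_subspace \<Gamma> T ?W"
    unfolding invariant_subspace_def using subspace_of_maximal_stretch[OF le]
    by (auto simp: intertwiner_apply[OF A] nT nS)
  moreover have "x\<^sub>0 \<in> ?W" "x\<^sub>0 \<noteq> 0"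
    using x0 by (auto simp: K_def)
  ultimately have "?W = UNIV"
    using irreducible_repD[OF T] by blast
  then have eq: "norm (A *v x) = K * norm x" for x
    by auto
  then have "K \<noteq> 0"
    using \<open>A \<noteq> 0\<close> by (auto simp: matrix_eq)
  then have "K > 0"
    by (simp add: K_def)
  with gram_matrix_of_similarity[OF eq] show ?thesis
    using that by blast
qed

section \<open>Arrangements as intertwining matrices\<close>

lemma arrangement_space_eq_range: "arrangement_space v = range ((*v) v)"
proof
  show "arrangement_space v \<subseteq> range ((*v) v)"
    unfolding arrangement_space_def
  proof (rule span_minimal)
    show "columns v \<subseteq> range ((*v) v)"
      by (auto simp: columns_def simp flip: matrix_vector_mult_basis)
    show "subspace (range ((*v) v))"
      by (simp add: linear_subspace_image)
  qed
  show "range ((*v) v) \<subseteq> arrangement_space v"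
    unfolding arrangement_space_def using matrix_vector_mult_in_columnspace by blast
qed

lemma permutation_group_bij:
  "permutation_group \<Gamma> \<Longrightarrow> \<phi> \<in> \<Gamma> \<Longrightarrow> bij \<phi>"
  using subgroup.subset[of \<Gamma> "BijGroup UNIV"]
  by (auto simp: permutation_group_def BijGroup_def Bij_def)

lemma perm_matrix_apply:
  assumes "bij \<phi>"
  shows "(perm_matrix \<phi> *v x) $ (\<phi> i) = x $ i"
  using bij_is_inj[OF assms] unfolding perm_matrix_def matrix_vector_mult_def
  by (simp add: inj_eq if_distrib[of "\<lambda>c. c * _"] cong: if_cong)

lemma orthogonal_perm_matrix:
  fixes \<phi> :: "'n::finite \<Rightarrow> 'n"
  assumes "bij \<phi>"
  shows "orthogonal_matrix (perm_matrix \<phi>)"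
proof -
  have "(norm (perm_matrix \<phi> *v x))\<^sup>2 = (norm x)\<^sup>2" for x
  proof -
    have "(norm (perm_matrix \<phi> *v x))\<^sup>2
        = (\<Sum>i\<in>UNIV. (perm_matrix \<phi> *v x) $ i * (perm_matrix \<phi> *v x) $ i)"
      by (simp add: power2_norm_eq_inner inner_vec_def)
    also have "\<dots> = (\<Sum>i\<in>UNIV. x $ i * x $ i)"
      by (subst sum.reindex_bij_betw[OF assms, symmetric]) (simp add: perm_matrix_apply[OF assms])
    finally show ?thesis
      by (simp add: power2_norm_eq_inner inner_vec_def)
  qed
  then have "norm (perm_matrix \<phi> *v x) = norm x" for x
    by (metis norm_ge_zero power2_eq_imp_eq)
  then show ?thesis
    by (simp add: orthogonal_matrix_iff_norm)
qed

text \<open>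
  Row \<open>\<phi> i\<close> of \<open>v T\<^sub>\<phi>\<close> is \<open>T\<^sub>\<phi>\<^sup>T (v $ \<phi> i)\<close>, and row \<open>\<phi> i\<close> of \<open>P\<^sub>\<phi> v\<close> is \<open>v $ i\<close>. Since \<open>T\<^sub>\<phi>\<close> is
  orthogonal, the two agree exactly when \<open>T\<^sub>\<phi>\<close> maps \<open>v $ i\<close> to \<open>v $ \<phi> i\<close>.
\<close>

lemma intertwiner_perm_matrix_iff:
  fixes v :: "real^'d^'n"
  assumes \<Gamma>: "permutation_group \<Gamma>"
    and T: "\<And>\<phi>. \<phi> \<in> \<Gamma> \<Longrightarrow> orthogonal_matrix (T \<phi>)"
  shows "intertwiner \<Gamma> T perm_matrix v \<longleftrightarrow> (\<forall>\<phi>\<in>\<Gamma>. \<forall>i. T \<phi> *v (v $ i) = v $ (\<phi> i))"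
  unfolding intertwiner_def
proof (intro ball_cong refl)
  fix \<phi> assume "\<phi> \<in> \<Gamma>"
  then have \<phi>: "bij \<phi>" and o: "orthogonal_matrix (T \<phi>)"
    using permutation_group_bij[OF \<Gamma>] T by auto
  have row: "(perm_matrix \<phi> ** v) $ (\<phi> i) = v $ i" for i
    unfolding vec_eq_iff
    using perm_matrix_apply[OF \<phi>, of "column j v" i for j]
    by (simp add: matrix_matrix_mult_def matrix_vector_mult_def column_def)
  have row': "(v ** T \<phi>) $ i = transpose (T \<phi>) *v (v $ i)" for i
    by (simp add: vec_eq_iff matrix_matrix_mult_def matrix_vector_mult_def transpose_def mult.commute)
  have flip: "transpose (T \<phi>) *v (v $ \<phi> i) = v $ i \<longleftrightarrow> T \<phi> *v (v $ i) = v $ \<phi> i" for i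
    using o unfolding orthogonal_matrix_def
    by (metis matrix_vector_mul_assoc matrix_vector_mul_lid)
  have "v ** T \<phi> = perm_matrix \<phi> ** v \<longleftrightarrow> (\<forall>i. (v ** T \<phi>) $ \<phi> i = (perm_matrix \<phi> ** v) $ \<phi> i)"
    using bij_is_surj[OF \<phi>] by (metis vec_eq_iff surj_def)
  then show "v ** T \<phi> = perm_matrix \<phi> ** v \<longleftrightarrow> (\<forall>i. T \<phi> *v (v $ i) = v $ \<phi> i)"
    by (simp add: row row' flip)
qed

lemma is_representation_orthogonal:
  "is_representation \<Gamma> v T \<Longrightarrow> \<phi> \<in> \<Gamma> \<Longrightarrow> orthogonal_matrix (T \<phi>)"
  by (auto simp: is_representation_def hom_def orthogonal_group_def Pi_iff)

lemma is_representation_intertwiner: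
  "permutation_group \<Gamma> \<Longrightarrow> is_representation \<Gamma> v T \<Longrightarrow> intertwiner \<Gamma> T perm_matrix v"
  using intertwiner_perm_matrix_iff is_representation_orthogonal
  by (metis is_representation_def)

lemma intertwiner_is_representation:
  assumes "permutation_group \<Gamma>" "is_representation \<Gamma> v T" "intertwiner \<Gamma> T perm_matrix w"
  shows "is_representation \<Gamma> w T"
  using assms intertwiner_perm_matrix_iff is_representation_orthogonal
  by (metis is_representation_def)

section \<open>Deforming along intertwiners of one representation\<close>

lemma gram_matrix_of_combination:
  fixes v w :: "real^'d^'n"
  assumes "transpose v ** v = mat 1" "transpose w ** w = mat 1"
    and overlap: "transpose v ** w = s *\<^sub>R mat 1"
  shows "transpose (a *\<^sub>R v + b *\<^sub>R w) ** (a *\<^sub>R v + b *\<^sub>R w)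
    = (a\<^sup>2 + b\<^sup>2 + 2 * a * b * s) *\<^sub>R mat 1"
proof -
  have wv: "transpose w ** v = s *\<^sub>R mat 1"
    using arg_cong[OF overlap(1), of transpose] by (simp add: matrix_transpose_mul transpose_scalar)
  have "transpose (a *\<^sub>R v + b *\<^sub>R w) = a *\<^sub>R transpose v + b *\<^sub>R transpose w"
    by (simp add: transpose_def vec_eq_iff)
  then have "transpose (a *\<^sub>R v + b *\<^sub>R w) ** (a *\<^sub>R v + b *\<^sub>R w)
      = a *\<^sub>R (a *\<^sub>R mat 1 + b *\<^sub>R s *\<^sub>R mat 1) + b *\<^sub>R (a *\<^sub>R s *\<^sub>R mat 1 + b *\<^sub>R mat 1)"
    by (simp only: matrix_add_ldistrib matrix_add_mult_distrib matrix_scalar_ac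
        scalar_matrix_assoc[symmetric] assms wv scaleR_add_right)
  also have "\<dots> = (a * (a + b * s) + b * (a * s + b)) *\<^sub>R mat 1"
    by (simp only: scaleR_add_left scaleR_add_right scaleR_scaleR distrib_left)
  also have "a * (a + b * s) + b * (a * s + b) = a\<^sup>2 + b\<^sup>2 + 2 * a * b * s"
    by (simp add: power2_eq_square algebra_simps)
  finally show ?thesis .
qed

text \<open>
  The Gram matrix of a convex combination of \<open>v\<close> and \<open>w\<close> is a multiple of the identity, and the
  sign of \<open>s\<close> keeps the factor away from zero. Hence the straight segment from \<open>v\<close> to \<open>w\<close> only has
  to be rescaled to run inside the arrangements.
\<close>

lemma deformable_of_positive_overlap:
  fixes v w :: "real^'d^'n"
  assumes \<Gamma>: "permutation_group \<Gamma>"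
    and v: "is_representation \<Gamma> v T" "normalized_arr v"
    and w: "is_representation \<Gamma> w T" "normalized_arr w"
    and overlap: "transpose v ** w = s *\<^sub>R mat 1" "s > 0"
  shows "deformable \<Gamma> v w"
proof -
  have vv: "transpose v ** v = mat 1" and ww: "transpose w ** w = mat 1"
    using v w by (auto simp: normalized_arr_def)
  define C where "C t = (1 - t) *\<^sub>R v + t *\<^sub>R w" for t
  define q where "q t = (1 - t)\<^sup>2 + t\<^sup>2 + 2 * t * (1 - t) * s" for t
  have gram: "transpose (C t) ** C t = q t *\<^sub>R mat 1" for t
    using gram_matrix_of_combination[OF vv ww overlap(1), of "1 - t" t]
    by (simp add: C_def q_def ac_simps)
  have pos: "q t > 0" if "t \<in> {0..1}" for t
  proof -
    have "0 \<le> 2 * t * (1 - t) * s"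
      using that \<open>s > 0\<close> by simp
    moreover have "(1 - t)\<^sup>2 + t\<^sup>2 > 0"
      by (simp add: sum_power2_gt_zero_iff)
    ultimately show ?thesis unfolding q_def by linarith
  qed
  define g where "g t = (1 / sqrt (q t)) *\<^sub>R C t" for t
  have "path g"
    unfolding path_def g_def C_def q_def
  proof (intro continuous_intros ballI)
    fix t :: real assume "t \<in> {0..1}"
    from pos[OF this] show "sqrt ((1 - t)\<^sup>2 + t\<^sup>2 + 2 * t * (1 - t) * s) \<noteq> 0"
      by (simp add: q_def)
  qed
  moreover have "g t \<in> arrangements \<Gamma>" if "t \<in> {0..1}" for t
  proof -
    have "intertwiner \<Gamma> T perm_matrix (g t)"
      unfolding g_def C_def
      by (intro intertwiner_scaleR intertwiner_add is_representation_intertwiner[OF \<Gamma>] v w)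
    then have "is_representation \<Gamma> (g t) T"
      by (rule intertwiner_is_representation[OF \<Gamma> v(1)])
    moreover have "normalized_arr (g t)"
      using pos[OF that]
      by (simp add: normalized_arr_def g_def transpose_scalar matrix_scalar_ac gram
          flip: scalar_matrix_assoc)
    ultimately show ?thesis
      by (auto simp: arrangements_def sym_arr_def)
  qed
  moreover have "pathstart g = v" "pathfinish g = w"
    by (auto simp: pathstart_def pathfinish_def g_def C_def q_def)
  ultimately show ?thesis
    unfolding deformable_def path_component_def path_image_def by blast
qed

text \<open>
  The arrangement is the rescaled inverse of \<open>v\<^sup>T\<close> restricted to \<open>V\<close>. With this choice \<open>v\<^sup>T w\<close> is
  automatically a positive scalar, whereas for an arbitrary equivariant isometry onto \<open>V\<close> it could
  be another element of the endomorphism algebra of \<open>T\<close>.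
\<close>

lemma arrangement_of_irreducible_subspace:
  fixes v :: "real^'d^'n"
  assumes \<Gamma>: "permutation_group \<Gamma>"
    and v: "is_representation \<Gamma> v T" "irreducible_rep \<Gamma> T"
    and V: "irreducible_subspace \<Gamma> perm_matrix V"
    and V_v: "\<not> (\<forall>x\<in>V. \<forall>y\<in>arrangement_space v. orthogonal x y)"
  obtains w s where "is_representation \<Gamma> w T" "normalized_arr w" "arrangement_space w = V"
    "transpose v ** w = s *\<^sub>R mat 1" "s > 0"
proof -
  note oT = is_representation_orthogonal[OF v(1)]
  note oP = orthogonal_perm_matrix[OF permutation_group_bij[OF \<Gamma>]]
  define B where "B = transpose v"
  have B: "intertwiner \<Gamma> perm_matrix T B"
    unfolding B_def by (intro intertwiner_transpose is_representation_intertwiner[OF \<Gamma> v(1)] oT oP)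
  have V_inv: "invariant_subspace \<Gamma> perm_matrix V"
    and V_min: "\<And>W. invariant_subspace \<Gamma> perm_matrix W \<Longrightarrow> W \<subseteq> V \<Longrightarrow> W = {0} \<or> W = V"
    using V by (auto simp: irreducible_subspace_def)
  have V_sub: "subspace V"
    using V_inv by (simp add: invariant_subspace_def)
  \<comment> \<open>Non-orthogonality says exactly that \<open>B\<close> does not vanish on \<open>V\<close>.\<close>
  obtain u where u: "u \<in> V" "B *v u \<noteq> 0"
  proof -
    obtain u y where "u \<in> V" "inner u (v *v y) \<noteq> 0"
      using V_v by (auto simp: arrangement_space_eq_range orthogonal_def)
    then show ?thesis
      using that[of u] unfolding B_def transpose_matrix_vector dot_lmul_matrix[symmetric] by fastforce
  qed
  have surj: "(*v) B ` V = UNIV"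
    using irreducible_repD[OF v(2) invariant_subspace_image[OF B V_inv]] u by blast
  have "V \<inter> {x. B *v x \<in> {0}} = {0}"
    using V_min[OF invariant_subspace_Int[OF V_inv
        invariant_subspace_preimage[OF B invariant_subspace_zero]]] u
    by blast
  then have ker: "x = 0" if "x \<in> V" "B *v x = 0" for x
    using that by blast
  have inj: "inj_on ((*v) B) V"
  proof (rule inj_onI)
    fix x y assume "x \<in> V" "y \<in> V" "B *v x = B *v y"
    then show "x = y"
      using ker[of "x - y"] V_sub
      by (simp add: subspace_diff matrix_vector_mult_diff_distrib)
  qed
  obtain g where "range g \<subseteq> V" "linear g" and gB: "\<And>x. x \<in> V \<Longrightarrow> g (B *v x) = x"
    using linear_exists_left_inverse_on[OF matrix_vector_mul_linear V_sub inj] by blast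
  define A where "A = matrix g"
  have A: "A *v x = g x" for x
    by (simp add: A_def \<open>linear g\<close> matrix_works)
  have AB: "A *v (B *v x) = x" if "x \<in> V" for x
    by (simp add: A gB that)
  have range_A: "range ((*v) A) = V"
  proof
    show "range ((*v) A) \<subseteq> V"
      using \<open>range g \<subseteq> V\<close> by (auto simp: A)
    show "V \<subseteq> range ((*v) A)"
      using AB by (metis rangeI subsetI)
  qed
  have BA: "B ** A = mat 1"
  proof -
    have "B *v (A *v y) = y" for y
    proof -
      obtain x where "x \<in> V" "y = B *v x"
        using surj by (metis UNIV_I imageE)
      then show ?thesis by (simp add: AB)
    qed
    then show ?thesis
      by (simp add: matrix_eq matrix_vector_mul_assoc)
  qed
  have A_int: "intertwiner \<Gamma> T perm_matrix A"
    unfolding intertwiner_def matrix_eq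
  proof (intro ballI allI)
    fix \<phi> y assume \<phi>: "\<phi> \<in> \<Gamma>"
    obtain x where x: "x \<in> V" "y = B *v x"
      using surj by (metis UNIV_I imageE)
    have "perm_matrix \<phi> *v x \<in> V"
      using V_inv x(1) \<phi> by (auto simp: invariant_subspace_def)
    with x show "(A ** T \<phi>) *v y = (perm_matrix \<phi> ** A) *v y"
      by (simp add: AB flip: matrix_vector_mul_assoc intertwiner_apply[OF B \<phi>])
  qed
  have "A \<noteq> 0"
    using AB[OF u(1)] u by auto
  obtain c where c: "c > 0" and gram: "transpose A ** A = c\<^sup>2 *\<^sub>R mat 1"
    by (rule Schur_gram_matrix[OF v(2) A_int \<open>A \<noteq> 0\<close> oT oP])
  define w where "w = (1 / c) *\<^sub>R A"
  show ?thesis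
  proof (rule that)
    show "is_representation \<Gamma> w T"
      unfolding w_def
      by (intro intertwiner_is_representation[OF \<Gamma> v(1)] intertwiner_scaleR A_int)
    show "normalized_arr w"
      using c by (simp add: normalized_arr_def w_def transpose_scalar matrix_scalar_ac gram
          power2_eq_square flip: scalar_matrix_assoc)
    show "arrangement_space w = V"
    proof -
      have "A *v x = w *v (c *\<^sub>R x)" "w *v x = A *v ((1 / c) *\<^sub>R x)" for x
        using c by (simp_all add: w_def matrix_vector_mult_scaleR flip: scaleR_matrix_vector_assoc)
      then have "range ((*v) w) = range ((*v) A)"
        by (metis (no_types, lifting) image_subset_iff rangeI subset_antisym)
      then show ?thesis by (simp add: arrangement_space_eq_range range_A)
    qed
    show "transpose v ** w = (1 / c) *\<^sub>R mat 1"
      using BA by (simp add: w_def B_def matrix_scalar_ac flip: scalar_matrix_assoc)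
    show "1 / c > 0"
      using c by simp
  qed
qed

section \<open>Deformations preserve the representation\<close>

text \<open>
  A closed formula for the representation of a normalized arrangement. It makes sense for every
  matrix, so that arrangements can be compared without choosing representations for them.
\<close>

definition gram_rep :: "real^'d^'n \<Rightarrow> ('n \<Rightarrow> 'n) \<Rightarrow> real^'d^'d" where
  "gram_rep v \<phi> = transpose v ** (perm_matrix \<phi> ** v)"

lemma representation_eq_gram_rep:
  assumes "permutation_group \<Gamma>" "is_representation \<Gamma> v T" "normalized_arr v" "\<phi> \<in> \<Gamma>"
  shows "T \<phi> = gram_rep v \<phi>"
proof -
  have "gram_rep v \<phi> = transpose v ** (v ** T \<phi>)"
    using is_representation_intertwiner[OF assms(1,2)] assms(4)
    by (simp add: gram_rep_def intertwiner_def)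
  also have "\<dots> = T \<phi>"
    using assms(3) by (simp add: matrix_mul_assoc normalized_arr_def)
  finally show ?thesis ..
qed

lemma gram_rep_is_representation:
  assumes "permutation_group \<Gamma>" "v \<in> arrangements \<Gamma>"
  obtains T where "is_representation \<Gamma> v T" "\<And>\<phi>. \<phi> \<in> \<Gamma> \<Longrightarrow> T \<phi> = gram_rep v \<phi>"
  using assms representation_eq_gram_rep unfolding arrangements_def sym_arr_def by blast

lemma isomorphic_rep_sym:
  assumes "isomorphic_rep \<Gamma> T S" shows "isomorphic_rep \<Gamma> S T"
proof -
  obtain R where R: "invertible R" "\<And>\<phi>. \<phi> \<in> \<Gamma> \<Longrightarrow> R ** T \<phi> = S \<phi> ** R"
    using assms by (auto simp: isomorphic_rep_def)
  then obtain Q where Q: "R ** Q = mat 1" "Q ** R = mat 1"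
    by (auto simp: invertible_def)
  have "Q ** S \<phi> = T \<phi> ** Q" if "\<phi> \<in> \<Gamma>" for \<phi>
    using R(2)[OF that] Q by (metis matrix_mul_assoc matrix_mul_lid matrix_mul_rid)
  moreover have "invertible Q"
    using Q by (auto simp: invertible_def)
  ultimately show ?thesis
    by (auto simp: isomorphic_rep_def)
qed

lemma isomorphic_rep_trans:
  assumes "isomorphic_rep \<Gamma> T S" "isomorphic_rep \<Gamma> S R" shows "isomorphic_rep \<Gamma> T R"
proof -
  obtain A B where "invertible A" "\<And>\<phi>. \<phi> \<in> \<Gamma> \<Longrightarrow> A ** T \<phi> = S \<phi> ** A"
    "invertible B" "\<And>\<phi>. \<phi> \<in> \<Gamma> \<Longrightarrow> B ** S \<phi> = R \<phi> ** B"
    using assms by (auto simp: isomorphic_rep_def)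
  then have "invertible (B ** A)" "\<And>\<phi>. \<phi> \<in> \<Gamma> \<Longrightarrow> (B ** A) ** T \<phi> = R \<phi> ** (B ** A)"
    by (auto simp: invertible_mult) (metis matrix_mul_assoc)
  then show ?thesis
    by (auto simp: isomorphic_rep_def)
qed

text \<open>
  The overlap of two arrangements intertwines their representations, as a composition of \<open>v\<close> with
  the adjoint of \<open>w\<close>.
\<close>

lemma gram_rep_isomorphic_of_overlap:
  assumes \<Gamma>: "permutation_group \<Gamma>" and v: "v \<in> arrangements \<Gamma>" and w: "w \<in> arrangements \<Gamma>"
    and inv: "invertible (transpose w ** v)"
  shows "isomorphic_rep \<Gamma> (gram_rep v) (gram_rep w)"
proof -
  obtain T where T: "is_representation \<Gamma> v T" "\<And>\<phi>. \<phi> \<in> \<Gamma> \<Longrightarrow> T \<phi> = gram_rep v \<phi>"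
    using gram_rep_is_representation[OF \<Gamma> v] by blast
  obtain S where S: "is_representation \<Gamma> w S" "\<And>\<phi>. \<phi> \<in> \<Gamma> \<Longrightarrow> S \<phi> = gram_rep w \<phi>"
    using gram_rep_is_representation[OF \<Gamma> w] by blast
  have "intertwiner \<Gamma> perm_matrix S (transpose w)"
    by (intro intertwiner_transpose is_representation_intertwiner[OF \<Gamma> S(1)]
        is_representation_orthogonal[OF S(1)] orthogonal_perm_matrix permutation_group_bij[OF \<Gamma>])
  then have "intertwiner \<Gamma> T S (transpose w ** v)"
    by (rule intertwiner_compose) (rule is_representation_intertwiner[OF \<Gamma> T(1)])
  then show ?thesis
    unfolding isomorphic_rep_def intertwiner_def using inv T(2) S(2) by auto
qed

lemma continuous_det_overlap:
  fixes a :: "real^'d^'n"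
  shows "continuous_on S (\<lambda>x::real^'d^'n. det (transpose x ** a))"
  unfolding det_def matrix_matrix_mult_def transpose_def
  by (simp, intro continuous_intros)

text \<open>
  Having isomorphic representations is an equivalence relation on a path component. Around each
  arrangement \<open>a\<close>, the overlap with \<open>a\<close> stays invertible, so the classes are open and
  connectedness leaves only one class.
\<close>

lemma deformable_imp_isomorphic_gram_rep:
  fixes v w :: "real^'d^'n"
  assumes \<Gamma>: "permutation_group \<Gamma>" and "deformable \<Gamma> v w"
  shows "isomorphic_rep \<Gamma> (gram_rep v) (gram_rep w)"
proof -
  define X where "X = path_component_set (arrangements \<Gamma>) v"
  have pc: "path_component (arrangements \<Gamma>) v w"
    using assms(2) by (simp add: deformable_def)
  have X_sub: "X \<subseteq> arrangements \<Gamma>"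
    unfolding X_def by (rule path_component_subset)
  show ?thesis
  proof (rule connected_equivalence_relation[where S = X
        and R = "\<lambda>v w. isomorphic_rep \<Gamma> (gram_rep v) (gram_rep w)"])
    show "connected X"
      unfolding X_def by (intro path_connected_imp_connected path_connected_path_component)
    show "v \<in> X" "w \<in> X"
      using pc path_component_mem(1)[OF pc] by (auto simp: X_def path_component_refl)
  next
    fix a assume a: "a \<in> X"
    let ?U = "{x \<in> X. det (transpose x ** a) \<in> - {0}}"
    have "openin (top_of_set X) ?U"
    proof -
      have "open (- {0::real})"
        by (simp add: open_Compl)
      from continuous_openin_preimage_gen[OF continuous_det_overlap this, of X a]
      show ?thesis
        by (simp add: vimage_def Int_def)
    qed
    moreover have "a \<in> ?U"
      using a X_sub by (auto simp: arrangements_def normalized_arr_def)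
    moreover have "isomorphic_rep \<Gamma> (gram_rep a) (gram_rep x)" if "x \<in> ?U" for x
      using that a X_sub
      by (intro gram_rep_isomorphic_of_overlap[OF \<Gamma>]) (auto simp: invertible_det_nz)
    ultimately show "\<exists>U. openin (top_of_set X) U \<and> a \<in> U \<and>
        (\<forall>x\<in>U. isomorphic_rep \<Gamma> (gram_rep a) (gram_rep x))"
      by blast
  qed (auto intro: isomorphic_rep_sym isomorphic_rep_trans)
qed

section \<open>The three characterisations of flexibility\<close>

text \<open>
  The subspace is the arrangement space of \<open>w\<close> unless that one is orthogonal to the arrangement
  space of \<open>v\<close>. In the orthogonal case, tilting the arrangement space of \<open>v\<close> towards that of \<open>w\<close>
  by an equivariant map gives one that is not orthogonal to it.
\<close>

lemma irreducible_subspace_of_isomorphic_arrangement: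
  fixes v w :: "real^'d^'n"
  assumes \<Gamma>: "permutation_group \<Gamma>"
    and v: "is_representation \<Gamma> v T" "normalized_arr v" "irreducible_rep \<Gamma> T"
    and w: "is_representation \<Gamma> w T'" "normalized_arr w" "isomorphic_rep \<Gamma> T T'"
    and neq: "\<not> equivalent_arr v w"
  shows "\<exists>V. irreducible_subspace \<Gamma> perm_matrix V \<and> V \<noteq> arrangement_space v \<and>
           \<not> (\<forall>x\<in>V. \<forall>y\<in>arrangement_space v. orthogonal x y)"
proof -
  have vv: "transpose v ** v = mat 1" and ww: "transpose w ** w = mat 1"
    using v w by (auto simp: normalized_arr_def)
  have v_int: "intertwiner \<Gamma> T perm_matrix v"
    by (rule is_representation_intertwiner[OF \<Gamma> v(1)])
  obtain R where R: "invertible R" "\<And>\<phi>. \<phi> \<in> \<Gamma> \<Longrightarrow> R ** T \<phi> = T' \<phi> ** R"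
    using w(3) by (auto simp: isomorphic_rep_def)
  define B where "B = w ** R"
  have B_int: "intertwiner \<Gamma> T perm_matrix B"
    unfolding B_def
    by (rule intertwiner_compose[OF is_representation_intertwiner[OF \<Gamma> w(1)]])
      (simp add: intertwiner_def R)
  obtain Q where Q: "R ** Q = mat 1" "Q ** R = mat 1"
    using R(1) by (auto simp: invertible_def)
  have B_inj: "x = 0" if "B *v x = 0" for x
  proof -
    have "x = (Q ** (transpose w ** w) ** R) *v x"
      by (simp add: ww Q)
    also have "\<dots> = Q *v (transpose w *v (B *v x))"
      by (simp add: B_def matrix_vector_mul_assoc matrix_mul_assoc)
    finally show ?thesis using that by simp
  qed
  have range_B: "range ((*v) B) = arrangement_space w"
  proof -
    have "B *v x = w *v (R *v x)" "w *v x = B *v (Q *v x)" for x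
      by (simp_all add: B_def matrix_vector_mul_assoc Q flip: matrix_mul_assoc)
    then have "range ((*v) B) = range ((*v) w)"
      by (metis (no_types, lifting) image_subset_iff rangeI subset_antisym)
    then show ?thesis by (simp add: arrangement_space_eq_range)
  qed
  \<comment> \<open>Any nonzero vector would do; there is one because index types are nonempty.\<close>
  have e: "(axis undefined 1 :: real^'d) \<noteq> 0"
    by (simp add: axis_eq_0_iff)
  show ?thesis
  proof (cases "\<forall>x\<in>arrangement_space w. \<forall>y\<in>arrangement_space v. orthogonal x y")
    case False
    have "B \<noteq> 0"
      using B_inj[of "axis undefined 1"] e by auto
    with False show ?thesis
      using irreducible_range[OF v(3) B_int] neq range_B
      by (auto simp: equivalent_arr_def)
  next
    case True
    have orth: "inner (B *v x) (v *v y) = 0" for x y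
    proof -
      have "B *v x \<in> arrangement_space w" "v *v y \<in> arrangement_space v"
        using range_B by (auto simp: arrangement_space_eq_range[of v])
      with True show ?thesis by (auto simp: orthogonal_def)
    qed
    have v_norm: "inner (v *v x) (v *v y) = inner x y" for x y
    proof -
      have "inner (v *v x) (v *v y) = inner ((transpose v ** v) *v x) y"
        by (simp add: transpose_matrix_vector dot_lmul_matrix flip: matrix_vector_mul_assoc)
      then show ?thesis by (simp add: vv)
    qed
    have overlap: "inner ((v + B) *v x) (v *v x) = inner x x" for x
      by (simp add: matrix_vector_mult_add_rdistrib inner_add_left orth v_norm)
    let ?e = "axis undefined 1 :: real^'d"
    have "v + B \<noteq> 0"
      using overlap[of ?e] e by auto
    then have "irreducible_subspace \<Gamma> perm_matrix (range ((*v) (v + B)))"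
      by (intro irreducible_range[OF v(3)] intertwiner_add v_int B_int)
    moreover have "range ((*v) (v + B)) \<noteq> arrangement_space v"
    proof
      assume "range ((*v) (v + B)) = arrangement_space v"
      then obtain y where "(v + B) *v ?e = v *v y"
        unfolding arrangement_space_eq_range by (metis (no_types, lifting) imageE rangeI)
      then have "B *v ?e = v *v (y - ?e)"
        by (simp add: matrix_vector_mult_add_rdistrib matrix_vector_mult_diff_distrib algebra_simps)
      then have "inner (B *v ?e) (B *v ?e) = 0"
        using orth[of ?e "y - ?e"] by simp
      then show False
        using B_inj[of ?e] e by simp
    qed
    moreover have "\<not> (\<forall>x\<in>range ((*v) (v + B)). \<forall>y\<in>arrangement_space v. orthogonal x y)"
    proof -
      have "\<not> orthogonal ((v + B) *v ?e) (v *v ?e)"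
        using overlap[of ?e] e by (simp add: orthogonal_def)
      then show ?thesis
        unfolding arrangement_space_eq_range by blast
    qed
    ultimately show ?thesis by blast
  qed
qed

theorem theorem5p11:
  fixes \<Gamma> :: "('n::finite \<Rightarrow> 'n) set"
    and v :: "real^'d^'n"
    and T :: "('n \<Rightarrow> 'n) \<Rightarrow> real^'d^'d"
    and U :: "(real^'n) set"
  assumes "permutation_group \<Gamma>"
    and "v \<in> arrangements \<Gamma>"
    and "U = arrangement_space v"
    and "is_representation \<Gamma> v T"
    and "irreducible_rep \<Gamma> T"
  shows "(flexible \<Gamma> v \<longleftrightarrow>
            (\<exists>w\<in>arrangements \<Gamma>. \<not> equivalent_arr v w \<and>
               (\<exists>T'. is_representation \<Gamma> w T' \<and> isomorphic_rep \<Gamma> T T'))) \<and>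
         (flexible \<Gamma> v \<longleftrightarrow>
            (\<exists>U'. irreducible_subspace \<Gamma> perm_matrix U' \<and> U' \<noteq> U \<and>
               \<not> (\<forall>x\<in>U'. \<forall>y\<in>U. orthogonal x y)))"
    (is "(?i \<longleftrightarrow> ?ii) \<and> (?i \<longleftrightarrow> ?iii)")
proof -
  have nv: "normalized_arr v"
    using assms(2) by (simp add: arrangements_def)
  have "?ii" if flexible: "?i"
  proof -
    obtain w where w: "w \<in> arrangements \<Gamma>" "deformable \<Gamma> v w" "\<not> equivalent_arr v w"
      using flexible unfolding rigid_def by blast
    obtain T' where T': "is_representation \<Gamma> w T'" "\<And>\<phi>. \<phi> \<in> \<Gamma> \<Longrightarrow> T' \<phi> = gram_rep w \<phi>"
      using gram_rep_is_representation[OF assms(1) w(1)] by blast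
    have "isomorphic_rep \<Gamma> T T'"
      using deformable_imp_isomorphic_gram_rep[OF assms(1) w(2)] T'(2)
        representation_eq_gram_rep[OF assms(1,4) nv]
      by (simp add: isomorphic_rep_def)
    with w T' show ?thesis by blast
  qed
  moreover have "?iii" if "?ii"
    using that irreducible_subspace_of_isomorphic_arrangement[OF assms(1,4) nv assms(5)]
    unfolding assms(3) arrangements_def by blast
  moreover have "?i" if V: "?iii"
  proof -
    obtain U' where U': "irreducible_subspace \<Gamma> perm_matrix U'" "U' \<noteq> arrangement_space v"
      "\<not> (\<forall>x\<in>U'. \<forall>y\<in>arrangement_space v. orthogonal x y)"
      using V assms(3) by blast
    obtain w s where w: "is_representation \<Gamma> w T" "normalized_arr w" "arrangement_space w = U'"
      "transpose v ** w = s *\<^sub>R mat 1" "s > 0"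
      by (rule arrangement_of_irreducible_subspace[OF assms(1,4,5) U'(1,3)])
    have "deformable \<Gamma> v w"
      by (rule deformable_of_positive_overlap[OF assms(1,4) nv w(1,2,4,5)])
    moreover have "w \<in> arrangements \<Gamma>"
      using w by (auto simp: arrangements_def sym_arr_def)
    ultimately show ?thesis
      using U'(2) w(3) by (auto simp: rigid_def equivalent_arr_def)
  qed
  ultimately show ?thesis by blast
qed

end
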